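(* Let $(X,\tau_1,\tau_2)$ be a $p$-normal bitopological space with $\tau_1\subset\tau_2$, and suppose $X=\bigcup_{k=1}^\infty F_k$ for a sequence $F_1,F_2,\ldots$ of 2-closed subsets of $X$, where each $F_k$ (with its bitopological subspace structure) is $(1,2)$-WS-supernormal in $X$. Suppose that at least one of the following holds: (a) $p\text{-}\mathrm{Ind}\,F_k=0$ for each $k\ge 1$; (b) $(X,\tau_1,\tau_2)$ is $d$-second countable and $p\text{-}\mathrm{ind}\,F_k=0$ for each $k\ge 1$. Then $p\text{-}\mathrm{Ind}\,X=0$.
   Context: A bitopological space $(X,\tau_1,\tau_2)$ is a set $X$ with two topologies. "$i$-open", "$i$-closed" refer to $\tau_i$; $\mathrm{co}\,\tau_i$ is the family of $\tau_i$-closed sets. A subset $Y\subset X$ is regarded as a bitopological subspace $(Y,\tau_1',\tau_2')$ with the induced topologies. $d$-second countable: both $\tau_1$ and $\tau_2$ are second countable. $p$-normal: for every pair of disjoint sets $A,B$ in $X$ with $A$ 1-closed and $B$ 2-closed there are a 2-open set $U$ and a 1-open set $V$ such that $A\subset U$, $B\subset V$, $U\cap V=\varnothing$. A subspace $(Y,\tau_1',\tau_2')$ of $(X,\tau_1,\tau_2)$ is $(1,2)$-WS-supernormal in $X$ if for each pair of disjoint sets $A\in\mathrm{co}\,\tau_1'$, $B\in\mathrm{co}\,\tau_2$ there are disjoint sets $U\in\tau_2'$, $V\in\tau_1$ such that $A\subset U$ and $B\subset V$. $p\text{-}\mathrm{ind}\,X=0$ means: $\tau_1$ has a base consisting of 2-closed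 sets and $\tau_2$ has a base consisting of 1-closed sets. $p\text{-}\mathrm{Ind}\,X=0$ means: for every 1-closed set $F$ and every 2-open $U\supset F$ there is $V\in\tau_2\cap\mathrm{co}\,\tau_1$ with $F\subset V\subset U$, and for every 2-closed set $\Phi$ and every 1-open $U\supset\Phi$ there is $V\in\tau_1\cap\mathrm{co}\,\tau_2$ with $\Phi\subset V\subset U$. *)

theory Defs
  imports "HOL-Analysis.Analysis"
begin

text \<open>
  A bitopological space is a pair of topologies on the same carrier. A subset \<open>Y\<close> is regarded
  as the bitopological space given by \<open>subtopology T1 Y\<close> and \<open>subtopology T2 Y\<close>.
\<close>

definition bitopological_space :: "'a topology \<Rightarrow> 'a topology \<Rightarrow> bool"
  where "bitopological_space T1 T2 \<longleftrightarrow> topspace T1 = topspace T2"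

definition d_second_countable :: "'a topology \<Rightarrow> 'a topology \<Rightarrow> bool"
  where "d_second_countable T1 T2 \<longleftrightarrow> second_countable T1 \<and> second_countable T2"

definition p_normal :: "'a topology \<Rightarrow> 'a topology \<Rightarrow> bool"
  where "p_normal T1 T2 \<longleftrightarrow>
    (\<forall>A B. closedin T1 A \<and> closedin T2 B \<and> disjnt A B \<longrightarrow>
      (\<exists>U V. openin T2 U \<and> openin T1 V \<and> A \<subseteq> U \<and> B \<subseteq> V \<and> disjnt U V))"

text \<open>
  The mixed levels are intended: \<open>A\<close> and \<open>U\<close> are relative to the subspace \<open>Y\<close>,
  while \<open>B\<close> and \<open>V\<close> are relative to the whole space.
\<close>

definition WS_supernormal_in :: "'a topology \<Rightarrow> 'a topology \<Rightarrow> 'a set \<Rightarrow> bool"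
  where "WS_supernormal_in T1 T2 Y \<longleftrightarrow>
    Y \<subseteq> topspace T1 \<and>
    (\<forall>A B. closedin (subtopology T1 Y) A \<and> closedin T2 B \<and> disjnt A B \<longrightarrow>
      (\<exists>U V. openin (subtopology T2 Y) U \<and> openin T1 V \<and> A \<subseteq> U \<and> B \<subseteq> V \<and> disjnt U V))"

definition is_base :: "'a topology \<Rightarrow> 'a set set \<Rightarrow> bool"
  where "is_base T \<B> \<longleftrightarrow>
    (\<forall>B\<in>\<B>. openin T B) \<and> (\<forall>U. openin T U \<longrightarrow> (\<exists>\<C>\<subseteq>\<B>. U = \<Union>\<C>))"

text \<open>
  In the two dimension notions below, the empty space counts as zero-dimensional.
\<close>

definition p_ind_zero :: "'a topology \<Rightarrow> 'a topology \<Rightarrow> bool"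
  where "p_ind_zero T1 T2 \<longleftrightarrow>
    (\<exists>\<B>. is_base T1 \<B> \<and> (\<forall>B\<in>\<B>. closedin T2 B)) \<and>
    (\<exists>\<B>. is_base T2 \<B> \<and> (\<forall>B\<in>\<B>. closedin T1 B))"

definition p_Ind_zero :: "'a topology \<Rightarrow> 'a topology \<Rightarrow> bool"
  where "p_Ind_zero T1 T2 \<longleftrightarrow>
    (\<forall>F U. closedin T1 F \<and> openin T2 U \<and> F \<subseteq> U \<longrightarrow>
      (\<exists>V. openin T2 V \<and> closedin T1 V \<and> F \<subseteq> V \<and> V \<subseteq> U)) \<and>
    (\<forall>F U. closedin T2 F \<and> openin T1 U \<and> F \<subseteq> U \<longrightarrow>
      (\<exists>V. openin T1 V \<and> closedin T2 V \<and> F \<subseteq> V \<and> V \<subseteq> U))"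

end

theory Submission
  imports Defs
begin

text \<open>
  Passing to complements, \<open>p_Ind_zero\<close> says that a 1-closed set \<open>A\<close> and a disjoint 2-closed set
  \<open>B\<close> are separated by a partition of the space into a 2-open \<open>U\<close> and a 1-open \<open>V\<close>.
  As in Urysohn's proof of the countable sum theorem, increasing neighbourhoods \<open>U\<^sub>n\<close> and \<open>V\<^sub>n\<close>
  with disjoint closures are constructed so that they cover \<open>F\<^sub>n\<close>, and \<open>U\<close>, \<open>V\<close> are their unions.
  In the inductive step a partition \<open>P\<close>, \<open>Q\<close> of \<open>F\<^sub>n\<close> has to be absorbed; \<open>Q\<close> is 2-closed because
  \<open>F\<^sub>n\<close> is, but \<open>P\<close> need not be 1-closed in the whole space. WS-supernormality repairs this: it yields
  a 1-open set containing \<open>B \<union> Q\<close> and missing \<open>P\<close>, so the 1-closure of \<open>P\<close> also misses \<open>B \<union> Q\<close>.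
  Case (b) reduces to (a) by the usual Lindelof argument.
\<close>

text \<open>The parts of a partition are complements of each other, so the 2-open part is 1-closed
  and the 1-open part is 2-closed. The two clauses of \<open>p_Ind_zero\<close> swap under
  complementation, so one partition statement captures both.\<close>

lemma p_Ind_zero_iff_partition:
  assumes "topspace T1 = topspace T2"
  shows "p_Ind_zero T1 T2 \<longleftrightarrow>
    (\<forall>A B. closedin T1 A \<and> closedin T2 B \<and> disjnt A B \<longrightarrow>
      (\<exists>U V. openin T2 U \<and> openin T1 V \<and> A \<subseteq> U \<and> B \<subseteq> V \<and> disjnt U V \<and> U \<union> V = topspace T1))"
    (is "_ \<longleftrightarrow> ?R")
proof
  assume L: "p_Ind_zero T1 T2"
  show ?R
  proof (intro allI impI, elim conjE)
    fix A B assume A: "closedin T1 A" and B: "closedin T2 B" and "disjnt A B"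
    then have "A \<subseteq> topspace T2 - B"
      using assms closedin_subset[OF A] by (auto simp: disjnt_def)
    then obtain V where V: "openin T2 V" "closedin T1 V" "A \<subseteq> V" "V \<subseteq> topspace T2 - B"
      using L A B unfolding p_Ind_zero_def by (meson openin_diff openin_topspace)
    moreover from V have "openin T1 (topspace T1 - V)" by blast
    ultimately show "\<exists>U V. openin T2 U \<and> openin T1 V \<and> A \<subseteq> U \<and> B \<subseteq> V \<and> disjnt U V \<and> U \<union> V = topspace T1"
      using assms closedin_subset[OF B]
      by (rule_tac x=V in exI, rule_tac x="topspace T1 - V" in exI) (auto simp: disjnt_def)
  qed
next
  assume R: ?R
  show "p_Ind_zero T1 T2"
    unfolding p_Ind_zero_def
  proof (intro conjI allI impI; elim conjE)
    fix F U assume F: "closedin T1 F" and U: "openin T2 U" and "F \<subseteq> U"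
    then have "closedin T2 (topspace T2 - U)" "disjnt F (topspace T2 - U)"
      by (auto simp: disjnt_def)
    then obtain V W where *: "openin T2 V" "openin T1 W" "F \<subseteq> V" "topspace T2 - U \<subseteq> W" "disjnt V W"
        "V \<union> W = topspace T1"
      using R F by metis
    then have "V = topspace T1 - W" by (auto simp: disjnt_def)
    then have "closedin T1 V" using * by blast
    moreover have "V \<subseteq> U" using * assms by (auto simp: disjnt_def)
    ultimately show "\<exists>V. openin T2 V \<and> closedin T1 V \<and> F \<subseteq> V \<and> V \<subseteq> U"
      using * by blast
  next
    fix F U assume F: "closedin T2 F" and U: "openin T1 U" and "F \<subseteq> U"
    then have "closedin T1 (topspace T1 - U)" "disjnt (topspace T1 - U) F"
      by (auto simp: disjnt_def)
    then obtain V W where *: "openin T2 V" "openin T1 W" "topspace T1 - U \<subseteq> V" "F \<subseteq> W" "disjnt V W"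
        "V \<union> W = topspace T1"
      using R F by metis
    then have "W = topspace T2 - V" using assms by (auto simp: disjnt_def)
    then have "closedin T2 W" using * by blast
    moreover have "W \<subseteq> U" using * assms by (auto simp: disjnt_def)
    ultimately show "\<exists>V. openin T1 V \<and> closedin T2 V \<and> F \<subseteq> V \<and> V \<subseteq> U"
      using * by blast
  qed
qed

lemma is_base_local:
  assumes "is_base T \<B>" "openin T U" "x \<in> U"
  obtains B where "B \<in> \<B>" "x \<in> B" "B \<subseteq> U"
  using assms unfolding is_base_def by (metis Sup_upper Union_iff subsetD)

text \<open>Second countability passes to the arbitrary subspace \<open>S\<close>, which is
  therefore Lindelof. Adding \<open>{}\<close> to the base allows an enumeration by all naturals
  even when the countable subcover is empty.\<close>

lemma countable_subcover_from_base:
  assumes sc: "second_countable T" and "is_base T \<B>" "openin T U" "S \<subseteq> U"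
  obtains P where "range P \<subseteq> insert {} \<B>" "S \<subseteq> (\<Union>n::nat. P n)" "\<And>n. P n \<subseteq> U"
proof -
  let ?\<U> = "{B \<in> \<B>. B \<subseteq> U}"
  have "Lindelof_space (subtopology T S)"
    using sc by (simp add: second_countable_imp_Lindelof_space second_countable_subtopology)
  moreover have "S \<subseteq> topspace T" using assms(3,4) openin_subset by blast
  moreover have "\<forall>B\<in>?\<U>. openin T B" using assms(2) unfolding is_base_def by blast
  moreover have "S \<subseteq> \<Union>?\<U>"
  proof
    fix x assume "x \<in> S"
    then obtain B where "B \<in> \<B>" "x \<in> B" "B \<subseteq> U"
      using is_base_local[OF assms(2,3)] assms(4) by blast
    then show "x \<in> \<Union>?\<U>" by blast
  qed
  ultimately obtain \<V> where V: "countable \<V>" "\<V> \<subseteq> ?\<U>" "S \<subseteq> \<Union>\<V>"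
    unfolding Lindelof_space_subtopology_subset[OF \<open>S \<subseteq> topspace T\<close>] by (metis (no_types, lifting))
  define P where "P = from_nat_into (insert {} \<V>)"
  have "range P = insert {} \<V>" unfolding P_def using V(1) by (simp add: range_from_nat_into)
  then have P: "range P \<subseteq> insert {} \<B>" "S \<subseteq> (\<Union>n. P n)" "(\<Union>n. P n) \<subseteq> U"
    using V by auto
  show thesis by (rule that[OF P(1,2)]) (use P(3) in blast)
qed

lemma p_ind_zero_imp_p_Ind_zero:
  assumes top: "topspace T1 = topspace T2" and "d_second_countable T1 T2" and ind: "p_ind_zero T1 T2"
  shows "p_Ind_zero T1 T2"
  unfolding p_Ind_zero_iff_partition[OF top]
proof (intro allI impI, elim conjE)
  fix A B assume A: "closedin T1 A" and B: "closedin T2 B" and AB: "disjnt A B"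
  have sc: "second_countable T1" "second_countable T2"
    using assms(2) by (auto simp: d_second_countable_def)
  obtain \<B>1 \<B>2 where B1: "is_base T1 \<B>1" "\<forall>B\<in>\<B>1. closedin T2 B"
    and B2: "is_base T2 \<B>2" "\<forall>B\<in>\<B>2. closedin T1 B"
    using ind unfolding p_ind_zero_def by blast
  obtain P where P: "range P \<subseteq> insert {} \<B>2" "A \<subseteq> (\<Union>n::nat. P n)" "\<And>n. P n \<subseteq> topspace T2 - B"
    using countable_subcover_from_base[OF sc(2) B2(1), of "topspace T2 - B" A]
      B closedin_subset[OF A] AB top by (auto simp: disjnt_def)
  \<comment> \<open>The sets \<open>Q n\<close> cover the whole complement of \<open>A\<close>, not
    only \<open>B\<close>, so that the two families together cover the space.\<close>
  obtain Q where Q: "range Q \<subseteq> insert {} \<B>1" "topspace T1 - A \<subseteq> (\<Union>n::nat. Q n)"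
      "\<And>n. Q n \<subseteq> topspace T1 - A"
    using countable_subcover_from_base[OF sc(1) B1(1), of "topspace T1 - A" "topspace T1 - A"] A
    by auto
  have Pn: "openin T2 (P n)" "closedin T1 (P n)" for n
    using P(1) B2 unfolding is_base_def by (metis insert_iff rangeI subsetD closedin_empty openin_empty)+
  have Qn: "openin T1 (Q n)" "closedin T2 (Q n)" for n
    using Q(1) B1 unfolding is_base_def by (metis closedin_empty insert_iff openin_empty rangeI subsetD)+
  \<comment> \<open>Each point goes to the family that reaches it first; the bounds
    \<open>j<n\<close> and \<open>j\<le>n\<close> award ties to \<open>P\<close>. Only finite unions
    are removed, of 2-closed \<open>Q j\<close> and of 1-closed \<open>P j\<close>, so the
    differences stay 2-open and 1-open respectively.\<close>
  define U where "U = (\<Union>n. P n - (\<Union>j<n. Q j))"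
  define V where "V = (\<Union>n. Q n - (\<Union>j\<le>n. P j))"
  have "openin T2 U"
    unfolding U_def by (intro openin_Union) (auto intro!: openin_diff Pn closedin_Union Qn)
  moreover have "openin T1 V"
    unfolding V_def by (intro openin_Union) (auto intro!: openin_diff Qn closedin_Union Pn)
  moreover have "disjnt U V"
    unfolding U_def V_def disjnt_iff
  proof (intro allI notI, elim conjE UN_E)
    fix x m n assume "x \<in> P m - (\<Union>j<m. Q j)" "x \<in> Q n - (\<Union>j\<le>n. P j)"
    then show False by (cases "n < m") auto
  qed
  moreover have "U \<union> V = topspace T1"
  proof
    show "U \<union> V \<subseteq> topspace T1" unfolding U_def V_def using P(3) Q(3) top by blast
    show "topspace T1 \<subseteq> U \<union> V"
    proof
      fix x assume "x \<in> topspace T1"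
      then have ex: "\<exists>n. x \<in> P n \<or> x \<in> Q n" using P(2) Q(2) by blast
      define n where "n = (LEAST n. x \<in> P n \<or> x \<in> Q n)"
      have "x \<in> P n \<or> x \<in> Q n" unfolding n_def using ex by (rule LeastI_ex)
      moreover have "x \<notin> P j \<and> x \<notin> Q j" if "j < n" for j
        using that not_less_Least unfolding n_def by blast
      ultimately have "x \<in> P n - (\<Union>j<n. Q j) \<or> x \<in> Q n - (\<Union>j\<le>n. P j)"
        by (cases "x \<in> P n") (auto simp: le_less)
      then show "x \<in> U \<union> V" unfolding U_def V_def by blast
    qed
  qed
  moreover have "A \<inter> V = {}" unfolding V_def using Q(3) by blast
  moreover have "B \<inter> U = {}" unfolding U_def using P(3) by blast
  ultimately show "\<exists>U V. openin T2 U \<and> openin T1 V \<and> A \<subseteq> U \<and> B \<subseteq> V \<and> disjnt U V \<and> U \<union> V = topspace T1"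
    using closedin_subset[OF A] closedin_subset[OF B] top
    by (rule_tac x=U in exI, rule_tac x=V in exI) blast
qed

text \<open>Normality is used twice: first to keep the 1-closure of \<open>U\<close> off
  \<open>B\<close>, then to separate that closure from \<open>B\<close>. The closures are 1-closed
  and 2-closed, so they form a pair to which normality applies again.\<close>

lemma p_normal_disjoint_closures:
  assumes "topspace T1 = topspace T2" "p_normal T1 T2"
    and "closedin T1 A" "closedin T2 B" "disjnt A B"
  obtains U V where "openin T2 U" "openin T1 V" "A \<subseteq> U" "B \<subseteq> V"
    "disjnt (T1 closure_of U) (T2 closure_of V)"
proof -
  obtain U V' where 1: "openin T2 U" "openin T1 V'" "A \<subseteq> U" "B \<subseteq> V'" "disjnt U V'"
    using assms(2-) unfolding p_normal_def by meson
  then have "disjnt (T1 closure_of U) B"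
    by (metis disjnt_def disjnt_subset2 inf_commute openin_Int_closure_of_eq_empty)
  then obtain W V where 2: "openin T2 W" "openin T1 V" "T1 closure_of U \<subseteq> W" "B \<subseteq> V" "disjnt W V"
    using assms(2,4) closedin_closure_of unfolding p_normal_def by meson
  then have "disjnt (T1 closure_of U) (T2 closure_of V)"
    by (metis disjnt_def disjnt_subset1 openin_Int_closure_of_eq_empty)
  with 1 2 that show thesis by blast
qed

lemma absorb_WS_supernormal_subspace:
  assumes top: "topspace T1 = topspace T2" and norm: "p_normal T1 T2"
    and Y: "closedin T2 Y" "WS_supernormal_in T1 T2 Y"
      "p_Ind_zero (subtopology T1 Y) (subtopology T2 Y)"
    and A: "closedin T1 A" and B: "closedin T2 B" and AB: "disjnt A B"
  obtains U V where "openin T2 U" "openin T1 V" "A \<subseteq> U" "B \<subseteq> V" "Y \<subseteq> U \<union> V"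
    "disjnt (T1 closure_of U) (T2 closure_of V)"
proof -
  let ?S1 = "subtopology T1 Y" and ?S2 = "subtopology T2 Y"
  have YX: "Y \<subseteq> topspace T1" using Y(2) by (simp add: WS_supernormal_in_def)
  then have tops: "topspace ?S1 = Y" "topspace ?S2 = Y" using top by auto
  have "closedin ?S1 (A \<inter> Y)" "closedin ?S2 (B \<inter> Y)" "disjnt (A \<inter> Y) (B \<inter> Y)"
    using A B AB by (auto simp: closedin_subtopology disjnt_def)
  then obtain P Q where PQ: "openin ?S2 P" "openin ?S1 Q" "A \<inter> Y \<subseteq> P" "B \<inter> Y \<subseteq> Q"
      "disjnt P Q" "P \<union> Q = Y"
    using Y(3) p_Ind_zero_iff_partition[of ?S1 ?S2] tops by metis
  have "Q = topspace ?S2 - P" "P = topspace ?S1 - Q"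
    using PQ(5,6) unfolding tops by (auto simp: disjnt_def)
  then have "closedin ?S2 Q" and P: "closedin ?S1 P"
    using PQ(1,2) by (metis closedin_diff closedin_topspace)+
  then have Q: "closedin T2 (B \<union> Q)"
    using B Y(1) closedin_trans_full by blast
  \<comment> \<open>\<open>P\<close> lies in \<open>Y\<close> and misses \<open>Q\<close>, which
    contains all of \<open>B\<close> inside \<open>Y\<close>.\<close>
  have "disjnt P (B \<union> Q)" using PQ by (auto simp: disjnt_def)
  then obtain N where N: "openin T1 N" "B \<union> Q \<subseteq> N" "disjnt P N"
    using Y(2) P Q unfolding WS_supernormal_in_def by (metis disjnt_subset1)
  then have "disjnt (T1 closure_of P) (B \<union> Q)"
    by (metis disjnt_def disjnt_subset2 inf_commute openin_Int_closure_of_eq_empty)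
  moreover have "disjnt A Q" using PQ by (auto simp: disjnt_def)
  ultimately have "disjnt (A \<union> T1 closure_of P) (B \<union> Q)"
    using AB by (auto simp: disjnt_def)
  then obtain U V where "openin T2 U" "openin T1 V" "A \<union> T1 closure_of P \<subseteq> U" "B \<union> Q \<subseteq> V"
    "disjnt (T1 closure_of U) (T2 closure_of V)"
    using p_normal_disjoint_closures[OF top norm _ Q] A by (metis closedin_Un closedin_closure_of)
  moreover have "P \<subseteq> T1 closure_of P" using PQ(6) YX by (auto intro!: closure_of_subset)
  ultimately show thesis using that PQ(6) by blast
qed

theorem p_Ind_zero_countable_sum:
  fixes F :: "nat \<Rightarrow> 'a set"
  assumes top: "topspace T1 = topspace T2" and norm: "p_normal T1 T2"
    and cover: "topspace T1 = (\<Union>n. F n)"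
    and F: "\<And>n. closedin T2 (F n)" "\<And>n. WS_supernormal_in T1 T2 (F n)"
      "\<And>n. p_Ind_zero (subtopology T1 (F n)) (subtopology T2 (F n))"
  shows "p_Ind_zero T1 T2"
  unfolding p_Ind_zero_iff_partition[OF top]
proof (intro allI impI, elim conjE)
  fix A B assume A: "closedin T1 A" and B: "closedin T2 B" and AB: "disjnt A B"
  note absorb = absorb_WS_supernormal_subspace[OF top norm F]
  \<comment> \<open>Disjoint closures are demanded, rather than just disjoint sets, so that the
    closures of one stage can replace \<open>A\<close> and \<open>B\<close> at the next.
    Monotonicity relates consecutive stages and is therefore the separate relation in the dependent
    choice.\<close>
  define good where "good n W \<longleftrightarrow> (case W of (U, V) \<Rightarrow>
      openin T2 U \<and> openin T1 V \<and> A \<subseteq> U \<and> B \<subseteq> V \<and> F n \<subseteq> U \<union> V \<and>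
      disjnt (T1 closure_of U) (T2 closure_of V))" for n W
  have "\<exists>W. good 0 W"
    using absorb[OF A B AB, of 0] unfolding good_def split_paired_Ex prod.case by metis
  moreover have "\<exists>W'. good (Suc n) W' \<and> fst W \<subseteq> fst W' \<and> snd W \<subseteq> snd W'" if "good n W" for n W
  proof -
    obtain U V where W: "W = (U, V)" by fastforce
    have g: "openin T2 U" "openin T1 V" "A \<subseteq> U" "B \<subseteq> V" "disjnt (T1 closure_of U) (T2 closure_of V)"
      using that W by (auto simp: good_def)
    have sub: "U \<subseteq> T1 closure_of U" "V \<subseteq> T2 closure_of V"
      using g(1,2) top by (metis closure_of_subset openin_subset)+
    obtain U' V' where "openin T2 U'" "openin T1 V'" "T1 closure_of U \<subseteq> U'" "T2 closure_of V \<subseteq> V'"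
      "F (Suc n) \<subseteq> U' \<union> V'" "disjnt (T1 closure_of U') (T2 closure_of V')"
      using absorb[OF closedin_closure_of closedin_closure_of g(5)] by metis
    then have "good (Suc n) (U', V') \<and> U \<subseteq> U' \<and> V \<subseteq> V'"
      using g sub by (auto simp: good_def)
    then show ?thesis using W by auto
  qed
  ultimately obtain W where W: "\<And>n. good n (W n)"
    and mono: "\<And>n. fst (W n) \<subseteq> fst (W (Suc n)) \<and> snd (W n) \<subseteq> snd (W (Suc n))"
    using dependent_nat_choice[of good "\<lambda>_ W W'. fst W \<subseteq> fst W' \<and> snd W \<subseteq> snd W'"] by metis
  define U V where "U = (\<lambda>n. fst (W n))" and "V = (\<lambda>n. snd (W n))"
  have g: "openin T2 (U n)" "openin T1 (V n)" "A \<subseteq> U n" "B \<subseteq> V n" "F n \<subseteq> U n \<union> V n"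
      "disjnt (T1 closure_of U n) (T2 closure_of V n)" for n
    using W[of n] by (auto simp: good_def U_def V_def split: prod.splits)
  have "incseq U" "incseq V" using mono by (auto simp: incseq_Suc_iff U_def V_def)
  have sub: "U n \<subseteq> topspace T1" "V n \<subseteq> topspace T1" for n
    using g(1,2)[of n] top by (metis openin_subset)+
  have "disjnt (U n) (V n)" for n
    using g(6)[of n] closure_of_subset[of "U n" T1] closure_of_subset[of "V n" T2] sub[of n] top
    by (auto simp: disjnt_iff)
  \<comment> \<open>A point common to \<open>U m\<close> and \<open>V n\<close> would lie in both
    sets of stage \<open>max m n\<close>, which are disjoint.\<close>
  moreover have "U m \<subseteq> U (max m n)" "V n \<subseteq> V (max m n)" for m n
    using \<open>incseq U\<close> \<open>incseq V\<close> by (simp_all add: incseqD)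
  ultimately have "disjnt (\<Union>n. U n) (\<Union>n. V n)"
    unfolding disjnt_iff by blast
  moreover have "(\<Union>n. U n) \<union> (\<Union>n. V n) = topspace T1"
  proof
    show "(\<Union>n. U n) \<union> (\<Union>n. V n) \<subseteq> topspace T1" using sub by blast
    show "topspace T1 \<subseteq> (\<Union>n. U n) \<union> (\<Union>n. V n)" unfolding cover using g(5) by blast
  qed
  moreover have "openin T2 (\<Union>n. U n)" "openin T1 (\<Union>n. V n)"
    using g(1,2) by (auto intro: openin_Union)
  moreover have "A \<subseteq> (\<Union>n. U n)" "B \<subseteq> (\<Union>n. V n)"
    using g(3,4) by (meson UN_upper UNIV_I order_trans)+
  ultimately show "\<exists>U V. openin T2 U \<and> openin T1 V \<and> A \<subseteq> U \<and> B \<subseteq> V \<and> disjnt U V \<and> U \<union> V = topspace T1"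
    by (intro exI conjI)
qed

theorem corollary2p25:
  fixes T1 T2 :: "'a topology" and F :: "nat \<Rightarrow> 'a set"
  assumes "bitopological_space T1 T2"
    and "p_normal T1 T2"
    and "\<forall>U. openin T1 U \<longrightarrow> openin T2 U"
    and "topspace T1 = (\<Union>k\<in>{1..}. F k)"
    and "\<forall>k\<ge>1. closedin T2 (F k)"
    and "\<forall>k\<ge>1. WS_supernormal_in T1 T2 (F k)"
    and "(\<forall>k\<ge>1. p_Ind_zero (subtopology T1 (F k)) (subtopology T2 (F k))) \<or>
         (d_second_countable T1 T2 \<and>
          (\<forall>k\<ge>1. p_ind_zero (subtopology T1 (F k)) (subtopology T2 (F k))))"
  shows "p_Ind_zero T1 T2"
proof (rule p_Ind_zero_countable_sum[where F = "\<lambda>n. F (Suc n)"])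
  show top: "topspace T1 = topspace T2"
    using assms(1) by (simp add: bitopological_space_def)
  \<comment> \<open>The given sequence starts at 1 and the sum theorem at 0, hence the
    shift.\<close>
  show "topspace T1 = (\<Union>n. F (Suc n))"
    unfolding assms(4) by (force simp: image_iff dest: Suc_le_D)
  show "p_Ind_zero (subtopology T1 (F (Suc n))) (subtopology T2 (F (Suc n)))" for n
    using assms(7)
  proof
    assume "d_second_countable T1 T2 \<and>
          (\<forall>k\<ge>1. p_ind_zero (subtopology T1 (F k)) (subtopology T2 (F k)))"
    \<comment> \<open>Second countability of both topologies is inherited by
      \<open>F (Suc n)\<close>, so case (b) yields case (a) piece by piece.\<close>
    then show ?thesis
      by (intro p_ind_zero_imp_p_Ind_zero)
        (auto simp: top d_second_countable_def second_countable_subtopology)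
  qed simp
qed (use assms in auto)

end
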